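(* There is only one value $\ell=\ell_J$ of the capture radius $\ell\in(0,+\infty)$ for which the line $\tilde{\mathcal B}_{\mathcal{PL}}^{\upsilon}$ crosses the line $\tilde{\mathcal B}_{\mathcal{UL}}^{-\upsilon}$, where $\upsilon\in\{-1,+1\}$. That is, there is exactly one $\ell_J>0$ such that, for $\upsilon\in\{-1,+1\}$ and $\ell>0$, $\tilde{\mathcal B}_{\mathcal{PL}}^{\upsilon}\cap\tilde{\mathcal B}_{\mathcal{UL}}^{-\upsilon}\neq\emptyset$ if and only if $\ell=\ell_J$.
   Context: $\mathbb S=\mathbb R/2\pi\mathbb Z$. For a capture radius $\ell>0$ and $\upsilon\in\{-1,+1\}$, the lines are the following curves in $\mathbb R^2\times\mathbb S$ (they depend on $\ell$): $$\tilde{\mathcal B}_{\mathcal{PL}}^{\upsilon}=\{\bar{\boldsymbol z}_{\mathcal B_{\mathcal{PL}}^\upsilon}(\vartheta):\vartheta\in(0,2\pi)\},\qquad \bar{\boldsymbol z}_{\mathcal B_{\mathcal{PL}}^\upsilon}(\vartheta)=\begin{bmatrix}-\upsilon\left(\ell\sin\frac\vartheta2+2\cos\frac\vartheta2+1+\cos\vartheta\right)\\-\ell\cos\frac\vartheta2+2\sin\frac\vartheta2+\sin\vartheta\\(1-\upsilon)\pi+\upsilon\vartheta\end{bmatrix},$$ $$\tilde{\mathcal B}_{\mathcal{UL}}^{\upsilon}=\{\bar{\boldsymbol z}_{\mathcal B_{\mathcal{UL}}^\upsilon}(\vartheta):\vartheta\in(0,2\pi)\},\qquad \bar{\boldsymbol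 z}_{\mathcal B_{\mathcal{UL}}^\upsilon}(\vartheta)=\begin{bmatrix}\upsilon(1-\cos\vartheta)\\\ell+\vartheta-\sin\vartheta\\(1+\upsilon)\pi-\upsilon\vartheta\end{bmatrix}.$$ In both cases the third component is taken in $\mathbb S$ (modulo $2\pi$). "Crosses" means having a common point. *)

theory Defs
  imports Complex_Main "HOL-Library.Real_Mod"
begin

text \<open>The circle \<open>\<real> / 2\<pi>\<int>\<close>; \<open>abs_circle\<close> is the projection \<open>\<real> \<rightarrow> \<real> / 2\<pi>\<int>\<close>.\<close>

quotient_type circle = real / "\<lambda>x y. [x = y] (rmod (2 * pi))"
  by (auto intro!: equivpI reflpI sympI transpI intro: rcong_sym rcong_trans)

text \<open>The sign \<open>\<upsilon>\<close> is a real number, meant to range over \<open>{-1, 1}\<close>.\<close>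

definition z_PL :: "real \<Rightarrow> real \<Rightarrow> real \<Rightarrow> real \<times> real \<times> circle" where
  "z_PL l \<upsilon> \<theta> =
     (- \<upsilon> * (l * sin (\<theta> / 2) + 2 * cos (\<theta> / 2) + 1 + cos \<theta>),
      - l * cos (\<theta> / 2) + 2 * sin (\<theta> / 2) + sin \<theta>,
      abs_circle ((1 - \<upsilon>) * pi + \<upsilon> * \<theta>))"

definition z_UL :: "real \<Rightarrow> real \<Rightarrow> real \<Rightarrow> real \<times> real \<times> circle" where
  "z_UL l \<upsilon> \<theta> =
     (\<upsilon> * (1 - cos \<theta>),
      l + \<theta> - sin \<theta>,
      abs_circle ((1 + \<upsilon>) * pi - \<upsilon> * \<theta>))"

definition B_PL :: "real \<Rightarrow> real \<Rightarrow> (real \<times> real \<times> circle) set" where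
  "B_PL l \<upsilon> = z_PL l \<upsilon> ` {0<..<2 * pi}"

definition B_UL :: "real \<Rightarrow> real \<Rightarrow> (real \<times> real \<times> circle) set" where
  "B_UL l \<upsilon> = z_UL l \<upsilon> ` {0<..<2 * pi}"

end

theory Submission
  imports Defs
begin

text \<open>
  The angular coordinates of the two lines agree only at equal parameters \<open>\<theta>\<close>. In terms of
  \<open>t = \<theta> / 2\<close>, \<open>c = cos t\<close>, \<open>s = sin t\<close>, the other two coordinates then agree iff
  \<open>l * s = 2 * (1 - 2 * c) * (1 + c)\<close> and \<open>l * (1 + c) = 2 * s + 4 * s * c - 2 * t\<close>, whichever
  sign \<open>\<upsilon>\<close> is chosen (\<open>lines_cross_iff\<close>). The first equation determines \<open>l\<close> from \<open>t\<close>. Multiplying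
  the second by \<open>s\<close> and eliminating \<open>l\<close>, everything cancels down to the equation
  \<open>2 * c * (1 + c) = t * s\<close> in \<open>t\<close> alone (\<open>eliminate_radius\<close>).

  Its left-hand side decreases and its right-hand side increases on \<open>[0, \<pi>/2]\<close>, while on
  \<open>[\<pi>/2, \<pi>)\<close> the former is at most \<open>0\<close> and the latter is positive; so it has at most one root in
  \<open>(0, \<pi>)\<close>. The left-hand side is the larger one at \<open>\<pi>/3\<close> and the smaller one at \<open>\<pi>/2\<close>, which
  gives a root beyond \<open>\<pi>/3\<close> (\<open>reduced_equation_root\<close>). There \<open>c < 1/2\<close>, so that the
  corresponding \<open>l\<close> is positive.
\<close>

text \<open>
  Both \<open>z_PL l \<upsilon>\<close> and \<open>z_UL l (- \<upsilon>)\<close> have this angular coordinate. As the parameters differ by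
  less than \<open>2\<pi>\<close> and \<open>\<upsilon>\<close> is a sign, congruence modulo \<open>2\<pi>\<close> forces equality.
\<close>

lemma abs_circle_signed_eq_iff:
  fixes \<upsilon> a b :: real
  assumes "\<upsilon> \<in> {-1, 1}" "a \<in> {0<..<2 * pi}" "b \<in> {0<..<2 * pi}"
  shows "abs_circle ((1 - \<upsilon>) * pi + \<upsilon> * a) = abs_circle ((1 - \<upsilon>) * pi + \<upsilon> * b) \<longleftrightarrow> a = b"
proof
  assume "abs_circle ((1 - \<upsilon>) * pi + \<upsilon> * a) = abs_circle ((1 - \<upsilon>) * pi + \<upsilon> * b)"
  then have "[(1 - \<upsilon>) * pi + \<upsilon> * a = (1 - \<upsilon>) * pi + \<upsilon> * b] (rmod (2 * pi))"
    by (simp add: circle.abs_eq_iff)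
  then obtain n :: int where n: "\<upsilon> * b = \<upsilon> * a + of_int n * (2 * pi)"
    by (auto simp: rcong_altdef)
  have "\<bar>\<upsilon> * b - \<upsilon> * a\<bar> < 2 * pi"
    using assms by auto
  then have "\<bar>of_int n :: real\<bar> * (2 * pi) < 1 * (2 * pi)"
    using n by (simp add: abs_mult)
  then have "\<bar>of_int n :: real\<bar> < 1"
    by (subst (asm) mult_less_cancel_right_pos) auto
  then have "n = 0"
    by linarith
  then show "a = b"
    using n assms(1) by auto
qed simp

lemma lines_cross_iff:
  fixes \<upsilon> l :: real
  assumes "\<upsilon> \<in> {-1, 1}"
  shows "B_PL l \<upsilon> \<inter> B_UL l (- \<upsilon>) \<noteq> {} \<longleftrightarrow>
    (\<exists>t\<in>{0<..<pi}. l * sin t = 2 * (1 - 2 * cos t) * (1 + cos t) \<and>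
       l * (1 + cos t) = 2 * sin t + 4 * sin t * cos t - 2 * t)"
    (is "_ \<longleftrightarrow> (\<exists>t\<in>_. ?eqs t)")
proof -
  have z: "z_PL l \<upsilon> a = z_UL l (- \<upsilon>) b \<longleftrightarrow> a = b \<and> ?eqs (a / 2)"
    if "a \<in> {0<..<2 * pi}" "b \<in> {0<..<2 * pi}" for a b
  proof -
    have d: "cos a = 2 * cos (a / 2) ^ 2 - 1" "sin a = 2 * sin (a / 2) * cos (a / 2)"
      using cos_double_cos[of "a / 2"] sin_double[of "a / 2"] by simp_all
    have "z_PL l \<upsilon> a = z_UL l (- \<upsilon>) b \<longleftrightarrow> a = b \<and>
        - \<upsilon> * (l * sin (a / 2) + 2 * cos (a / 2) + 1 + cos a) = - \<upsilon> * (1 - cos a) \<and>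
        - l * cos (a / 2) + 2 * sin (a / 2) + sin a = l + a - sin a"
      using abs_circle_signed_eq_iff[OF assms that] by (auto simp: z_PL_def z_UL_def)
    also have "\<dots> \<longleftrightarrow> a = b \<and> ?eqs (a / 2)"
      using assms unfolding d by (auto simp: algebra_simps power2_eq_square)
    finally show ?thesis .
  qed
  have "B_PL l \<upsilon> \<inter> B_UL l (- \<upsilon>) \<noteq> {} \<longleftrightarrow>
      (\<exists>a\<in>{0<..<2 * pi}. \<exists>b\<in>{0<..<2 * pi}. z_PL l \<upsilon> a = z_UL l (- \<upsilon>) b)"
    by (auto simp: B_PL_def B_UL_def) (metis greaterThanLessThan_iff imageI)
  also have "\<dots> \<longleftrightarrow> (\<exists>a\<in>{0<..<2 * pi}. ?eqs (a / 2))"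
    using z by blast
  also have "\<dots> \<longleftrightarrow> (\<exists>t\<in>{0<..<pi}. ?eqs t)"
  proof
    assume "\<exists>t\<in>{0<..<pi}. ?eqs t"
    then obtain t where "t \<in> {0<..<pi}" "?eqs t" by blast
    then have "2 * t \<in> {0<..<2 * pi}" "?eqs (2 * t / 2)" by simp_all
    then show "\<exists>a\<in>{0<..<2 * pi}. ?eqs (a / 2)" by blast
  next
    assume "\<exists>a\<in>{0<..<2 * pi}. ?eqs (a / 2)"
    then obtain a where "a \<in> {0<..<2 * pi}" "?eqs (a / 2)" by blast
    then show "\<exists>t\<in>{0<..<pi}. ?eqs t"
      by (intro bexI[of _ "a / 2"]) auto
  qed
  finally show ?thesis .
qed

text \<open>
  Since \<open>s\<^sup>2 = (1 - c) * (1 + c)\<close>, both \<open>s * (l * (1 + c))\<close> and \<open>s * (2 * s + 4 * s * c)\<close> contain the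
  factor \<open>2 * (1 + c)\<close>. The cofactors \<open>(1 - 2 * c) * (1 + c)\<close> and \<open>(1 - c) * (1 + 2 * c)\<close> differ only
  in their linear terms, by \<open>- 2 * c\<close>.
\<close>

lemma eliminate_radius:
  fixes l s c t :: real
  assumes "s > 0" "s ^ 2 + c ^ 2 = 1" "l * s = 2 * (1 - 2 * c) * (1 + c)"
  shows "l * (1 + c) = 2 * s + 4 * s * c - 2 * t \<longleftrightarrow> 2 * c * (1 + c) = t * s"
proof -
  have s2: "s * s = 1 - c * c"
    using assms(2) by (simp add: power2_eq_square)
  define d where "d = l * (1 + c) - (2 * s + 4 * s * c - 2 * t)"
  have "s * d = (l * s) * (1 + c) - (s * s) * (2 + 4 * c) + 2 * (t * s)"
    by (simp add: d_def algebra_simps)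
  also have "\<dots> = 2 * (t * s - 2 * c * (1 + c))"
    unfolding assms(3) s2 by (simp add: algebra_simps)
  finally have sd: "s * d = 2 * (t * s - 2 * c * (1 + c))" .
  have "d = 0 \<longleftrightarrow> s * d = 0"
    using assms(1) by simp
  also have "\<dots> \<longleftrightarrow> 2 * c * (1 + c) = t * s"
    unfolding sd by (auto simp: algebra_simps)
  finally show ?thesis
    unfolding d_def by (simp only: right_minus_eq)
qed

lemma root_less_pi_half:
  fixes t :: real
  assumes "t \<in> {0<..<pi}" "2 * cos t * (1 + cos t) = t * sin t"
  shows "t < pi / 2"
proof (rule ccontr)
  assume "\<not> t < pi / 2"
  then have "cos t \<le> 0"
    using assms(1) cos_monotone_0_pi_le[of "pi / 2" t] by simp
  moreover have "0 \<le> 1 + cos t"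
    using cos_ge_minus_one[of t] by linarith
  ultimately have "2 * cos t * (1 + cos t) \<le> 0"
    by (simp add: mult_nonpos_nonneg)
  moreover have "0 < t * sin t"
    using assms(1) sin_gt_zero[of t] by simp
  ultimately show False
    using assms(2) by linarith
qed

lemma reduced_equation_strict_mono:
  fixes t u :: real
  assumes "0 < t" "t < u" "u < pi / 2"
  shows "t * sin t - 2 * cos t * (1 + cos t) < u * sin u - 2 * cos u * (1 + cos u)"
proof -
  have "sin t < sin u"
    using assms by (intro sin_monotone_2pi) auto
  moreover have "0 < sin t"
    using assms by (intro sin_gt_zero) auto
  ultimately have "t * sin t < u * sin u"
    using assms by (intro mult_strict_mono) auto
  moreover have "cos u < cos t" "0 < cos u"
    using assms by (auto intro: cos_monotone_0_pi cos_gt_zero)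
  then have "cos u * (1 + cos u) < cos t * (1 + cos t)"
    by (intro mult_strict_mono) auto
  ultimately show ?thesis
    by linarith
qed

text \<open>
  Beyond \<open>\<pi>/3\<close> is where \<open>1 - 2 * cos t\<close>, and with it the radius belonging to \<open>t\<close>, is positive.
\<close>

lemma reduced_equation_root:
  obtains t\<^sub>0 :: real where "pi / 3 < t\<^sub>0" "t\<^sub>0 < pi"
    "\<And>t. t \<in> {0<..<pi} \<Longrightarrow> 2 * cos t * (1 + cos t) = t * sin t \<longleftrightarrow> t = t\<^sub>0"
proof -
  define g :: "real \<Rightarrow> real" where "g t = t * sin t - 2 * cos t * (1 + cos t)" for t
  \<comment> \<open>\<open>g (\<pi>/3) = \<pi> * sqrt 3 / 6 - 3/2\<close>, so any bound up to \<open>9\<close> makes it negative.\<close>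
  have "pi * sqrt 3 < 4 * 2"
    using pi_less_4 by (intro mult_strict_mono) (auto intro: real_less_lsqrt)
  then have neg: "g (pi / 3) < 0"
    by (simp add: g_def sin_60 cos_60)
  have pos: "g (pi / 2) \<ge> 0"
    by (simp add: g_def)
  have "\<exists>t\<ge>pi / 3. t \<le> pi / 2 \<and> g t = 0"
    using neg pos by (intro IVT') (auto simp: g_def intro!: continuous_intros)
  then obtain t0 where t0: "pi / 3 \<le> t0" "t0 \<le> pi / 2" "g t0 = 0"
    by blast
  have "pi / 3 \<noteq> t0"
  proof
    assume "pi / 3 = t0"
    from neg[unfolded this] show False
      using t0(3) by linarith
  qed
  then have in0: "pi / 3 < t0" "t0 < pi"
    using t0(1,2) pi_gt_zero by linarith+
  have root_iff: "2 * cos t * (1 + cos t) = t * sin t \<longleftrightarrow> g t = 0" for t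
    unfolding g_def by (rule iffI; linarith)
  have "t = t0" if t: "t \<in> {0<..<pi}" "g t = 0" for t
  proof -
    have t0_in: "t0 \<in> {0<..<pi}"
      using less_trans[of 0 "pi / 3" t0] in0 by simp
    have "t < pi / 2" "t0 < pi / 2"
      using t t0_in t0(3) root_less_pi_half[unfolded root_iff] by blast+
    then have "\<not> t < t0" "\<not> t0 < t"
      using reduced_equation_strict_mono[of t t0, folded g_def]
        reduced_equation_strict_mono[of t0 t, folded g_def] t t0_in t0(3) by auto
    then show ?thesis
      by simp
  qed
  then have "2 * cos t * (1 + cos t) = t * sin t \<longleftrightarrow> t = t0" if "t \<in> {0<..<pi}" for t
    unfolding root_iff using that t0(3) by blast
  with in0 show thesis
    by (rule that)
qed

theorem lemma4p1:
  shows "\<exists>!l\<^sub>J::real. l\<^sub>J > 0 \<and>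
    (\<forall>\<upsilon>\<in>{-1, 1::real}. \<forall>l::real. l > 0 \<longrightarrow>
      (B_PL l \<upsilon> \<inter> B_UL l (- \<upsilon>) \<noteq> {} \<longleftrightarrow> l = l\<^sub>J))"
proof -
  obtain t0 :: real where t0: "pi / 3 < t0" "t0 < pi"
    and root: "\<And>t. t \<in> {0<..<pi} \<Longrightarrow> 2 * cos t * (1 + cos t) = t * sin t \<longleftrightarrow> t = t0"
    using reduced_equation_root by blast
  have t0_in: "t0 \<in> {0<..<pi}"
    using less_trans[of 0 "pi / 3" t0] t0 by simp
  then have s0: "sin t0 > 0"
    by (auto intro: sin_gt_zero)
  define L where "L = 2 * (1 - 2 * cos t0) * (1 + cos t0) / sin t0"
  have "cos t0 < 1 / 2"
    using cos_monotone_0_pi[of "pi / 3" t0] t0 by (simp add: cos_60)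
  moreover have "-1 < cos t0"
    using cos_monotone_0_pi[of t0 pi] t0_in by simp
  ultimately have "L > 0"
    using s0 by (simp add: L_def)
  have cross: "B_PL l \<upsilon> \<inter> B_UL l (- \<upsilon>) \<noteq> {} \<longleftrightarrow> l = L" if "\<upsilon> \<in> {-1, 1}" for \<upsilon> l :: real
  proof -
    have "B_PL l \<upsilon> \<inter> B_UL l (- \<upsilon>) \<noteq> {} \<longleftrightarrow>
      (\<exists>t\<in>{0<..<pi}. l * sin t = 2 * (1 - 2 * cos t) * (1 + cos t) \<and>
         2 * cos t * (1 + cos t) = t * sin t)"
      unfolding lines_cross_iff[OF that]
      by (intro bex_cong conj_cong refl eliminate_radius) (auto intro: sin_gt_zero)
    also have "\<dots> \<longleftrightarrow> l * sin t0 = 2 * (1 - 2 * cos t0) * (1 + cos t0)"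
      using root t0_in by blast
    also have "\<dots> \<longleftrightarrow> l = L"
      using s0 by (simp add: L_def eq_divide_eq)
    finally show ?thesis .
  qed
  show ?thesis
  proof (rule ex1I[of _ L])
    show "L > 0 \<and> (\<forall>\<upsilon>\<in>{-1, 1::real}. \<forall>l::real. l > 0 \<longrightarrow>
        (B_PL l \<upsilon> \<inter> B_UL l (- \<upsilon>) \<noteq> {} \<longleftrightarrow> l = L))"
      using \<open>L > 0\<close> cross by blast
  next
    fix l' :: real
    assume "l' > 0 \<and> (\<forall>\<upsilon>\<in>{-1, 1::real}. \<forall>l::real. l > 0 \<longrightarrow>
        (B_PL l \<upsilon> \<inter> B_UL l (- \<upsilon>) \<noteq> {} \<longleftrightarrow> l = l'))"
    then show "l' = L"
      using cross[of 1 l'] by blast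
  qed
qed

end
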